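(* Let $X$ be a locally compact, non-compact Hausdorff space and let $(A,\|\cdot\|)$ be a natural regular Banach function algebra on $X$ with a bounded approximate identity contained in $A_c$. Let $n$ be a positive integer. Suppose that $\tau\in A_{\mathrm{loc}}$ and that $A$ is an ideal in its second dual. If $A_{\tau(n)}$ is a BSE-algebra, then $A$ is a BSE-algebra.
   Context: A Banach function algebra on $X$ is a subalgebra $A$ of $C_0(X)$ that separates strongly the points of $X$ (for $x\ne y$ in $X$ there is $f\in A$ with $f(x)\neq f(y)$, and for each $x\in X$ there is $f\in A$ with $f(x)\ne 0$) and is a Banach algebra under a norm $\|\cdot\|$. It is natural if $x\mapsto\phi_x$, $\phi_x(f)=f(x)$, is a homeomorphism of $X$ onto the character space $\Delta(A)$; so $\Delta(A)=X$. $A_c$ is the set of $f\in A$ with compact support. The second dual $A^{**}$ carries an Arens product, and $A$ is regarded as a subset of $A^{**}$ via the canonical embedding. A continuous function $\sigma:X\to\mathbb{C}$ is a local $A$-function if $f\sigma\in A$ for all $f\in A_c$; $A_{\mathrm{loc}}$ is the set of local $A$-functions. For a positive integer $n$ and continuous $\tau:X\to\mathbb{C}$, $A_{\tau(n)}=\{f\in A: f\tau^k\in A\ (0\le k\le n)\}$ with norm $\|f\|_{\tau(n)}=\sum_{k=0}^n\|f\tau^k\|$ and pointwise product. BSE-algebras. A commutative Banach algebra $A$ is without order if $a\in A$ and $aA=\{0\}$ imply $a=0$. A multiplier of $A$ is a linear operator $T:A\to A$ with $aT(b)=T(a)b$ for all $a,b\in A$; $\mathcal{M}(A)$ is the space of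 all multipliers. $\Delta(A)$ is the space of characters (non-zero homomorphisms $A\to\mathbb{C}$) with the Gel'fand topology, and $\widehat{a}(\phi)=\phi(a)$. For each $T\in\mathcal{M}(A)$ there is a unique bounded continuous function $\widehat{T}$ on $\Delta(A)$ with $\widehat{T(a)}(\phi)=\widehat{T}(\phi)\widehat{a}(\phi)$ for all $a\in A$, $\phi\in\Delta(A)$; put $\widehat{\mathcal{M}(A)}=\{\widehat{T}:T\in\mathcal{M}(A)\}$. A bounded continuous function $\sigma$ on $\Delta(A)$ is a BSE-function if there is a constant $C>0$ such that for all $\phi_1,\dots,\phi_n\in\Delta(A)$ and $c_1,\dots,c_n\in\mathbb{C}$, $\left|\sum_{i=1}^n c_i\sigma(\phi_i)\right|\le C\left\|\sum_{i=1}^n c_i\phi_i\right\|_{A^*}$; $C_{\mathrm{BSE}}(\Delta(A))$ is the set of all BSE-functions. A without order commutative Banach algebra $A$ is a BSE-algebra if $C_{\mathrm{BSE}}(\Delta(A))=\widehat{\mathcal{M}(A)}$. *)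

theory Defs
  imports "HOL-Analysis.Analysis"
begin

text \<open>
  An algebra is given by a carrier \<open>A\<close>, a set of complex-valued functions on a type, and a
  function \<open>N\<close> of which only the values on \<open>A\<close> matter, the norm. The operations are pointwise.
  A functional on \<open>A\<close> is a function on the ambient type that is \<open>0\<close> off \<open>A\<close>.
  A set of functionals is then again a set of complex-valued functions with pointwise operations,
  and the second dual is obtained by iterating \<open>dual\<close>.
\<close>

definition complex_subspace :: "('y \<Rightarrow> complex) set \<Rightarrow> bool" where
  "complex_subspace V \<longleftrightarrow>
     (\<lambda>_. 0) \<in> V \<and>
     (\<forall>f\<in>V. \<forall>g\<in>V. (\<lambda>y. f y + g y) \<in> V) \<and>
     (\<forall>c. \<forall>f\<in>V. (\<lambda>y. c * f y) \<in> V)"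

definition complex_subalgebra :: "('y \<Rightarrow> complex) set \<Rightarrow> bool" where
  "complex_subalgebra A \<longleftrightarrow>
     complex_subspace A \<and> (\<forall>f\<in>A. \<forall>g\<in>A. (\<lambda>y. f y * g y) \<in> A)"

definition norm_on :: "('y \<Rightarrow> complex) set \<Rightarrow> (('y \<Rightarrow> complex) \<Rightarrow> real) \<Rightarrow> bool" where
  "norm_on V N \<longleftrightarrow>
     (\<forall>f\<in>V. 0 \<le> N f \<and> (N f = 0 \<longleftrightarrow> f = (\<lambda>_. 0))) \<and>
     (\<forall>f\<in>V. \<forall>g\<in>V. N (\<lambda>y. f y + g y) \<le> N f + N g) \<and>
     (\<forall>c. \<forall>f\<in>V. N (\<lambda>y. c * f y) = cmod c * N f)"

definition complete_norm_on :: "('y \<Rightarrow> complex) set \<Rightarrow> (('y \<Rightarrow> complex) \<Rightarrow> real) \<Rightarrow> bool" where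
  "complete_norm_on V N \<longleftrightarrow>
     (\<forall>s :: nat \<Rightarrow> 'y \<Rightarrow> complex.
        (\<forall>k. s k \<in> V) \<and>
        (\<forall>e>0. \<exists>M. \<forall>k\<ge>M. \<forall>l\<ge>M. N (\<lambda>y. s k y - s l y) < e) \<longrightarrow>
        (\<exists>f\<in>V. (\<lambda>k. N (\<lambda>y. s k y - f y)) \<longlonglongrightarrow> 0))"

definition comm_banach_algebra :: "('y \<Rightarrow> complex) set \<Rightarrow> (('y \<Rightarrow> complex) \<Rightarrow> real) \<Rightarrow> bool" where
  "comm_banach_algebra A N \<longleftrightarrow>
     complex_subalgebra A \<and> norm_on A N \<and> complete_norm_on A N \<and>
     (\<forall>f\<in>A. \<forall>g\<in>A. N (\<lambda>y. f y * g y) \<le> N f * N g)"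

definition without_order :: "('y \<Rightarrow> complex) set \<Rightarrow> bool" where
  "without_order A \<longleftrightarrow>
     (\<forall>a\<in>A. (\<forall>b\<in>A. (\<lambda>y. a y * b y) = (\<lambda>_. 0)) \<longrightarrow> a = (\<lambda>_. 0))"


definition linear_functional :: "('y \<Rightarrow> complex) set \<Rightarrow> (('y \<Rightarrow> complex) \<Rightarrow> complex) \<Rightarrow> bool" where
  "linear_functional V \<psi> \<longleftrightarrow>
     (\<forall>f. f \<notin> V \<longrightarrow> \<psi> f = 0) \<and>
     (\<forall>f\<in>V. \<forall>g\<in>V. \<psi> (\<lambda>y. f y + g y) = \<psi> f + \<psi> g) \<and>
     (\<forall>c. \<forall>f\<in>V. \<psi> (\<lambda>y. c * f y) = c * \<psi> f)"

definition dual ::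
    "('y \<Rightarrow> complex) set \<Rightarrow> (('y \<Rightarrow> complex) \<Rightarrow> real) \<Rightarrow> (('y \<Rightarrow> complex) \<Rightarrow> complex) set" where
  "dual V N = {\<psi>. linear_functional V \<psi> \<and> (\<exists>C. \<forall>f\<in>V. cmod (\<psi> f) \<le> C * N f)}"

definition dual_norm ::
    "('y \<Rightarrow> complex) set \<Rightarrow> (('y \<Rightarrow> complex) \<Rightarrow> real) \<Rightarrow> (('y \<Rightarrow> complex) \<Rightarrow> complex) \<Rightarrow> real" where
  "dual_norm V N \<psi> = (SUP f\<in>{f\<in>V. N f \<le> 1}. cmod (\<psi> f))"

definition second_dual ::
    "('y \<Rightarrow> complex) set \<Rightarrow> (('y \<Rightarrow> complex) \<Rightarrow> real)
       \<Rightarrow> ((('y \<Rightarrow> complex) \<Rightarrow> complex) \<Rightarrow> complex) set" where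
  "second_dual V N = dual (dual V N) (dual_norm V N)"

definition canonical_embedding ::
    "('y \<Rightarrow> complex) set \<Rightarrow> (('y \<Rightarrow> complex) \<Rightarrow> real) \<Rightarrow> ('y \<Rightarrow> complex)
       \<Rightarrow> (('y \<Rightarrow> complex) \<Rightarrow> complex) \<Rightarrow> complex" where
  "canonical_embedding V N f = (\<lambda>\<psi>. if \<psi> \<in> dual V N then \<psi> f else 0)"

text \<open>
  The first Arens product is defined in three steps, for \<open>a, b \<in> A\<close>, \<open>\<psi> \<in> A\<^sup>*\<close> and
  \<open>E, F \<in> A\<^sup>*\<^sup>*\<close>: \<open>(\<psi> \<cdot> a)(b) = \<psi>(a b)\<close>, \<open>(F \<cdot> \<psi>)(a) = F(\<psi> \<cdot> a)\<close> and \<open>(E F)(\<psi>) = E(F \<cdot> \<psi>)\<close>.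
  If \<open>E\<close> or \<open>F\<close> lies in the image of \<open>A\<close>, the second Arens product gives the same value, so
  that being an ideal in the second dual does not depend on the choice.
\<close>

definition dual_module_act ::
    "('y \<Rightarrow> complex) set \<Rightarrow> (('y \<Rightarrow> complex) \<Rightarrow> complex) \<Rightarrow> ('y \<Rightarrow> complex)
       \<Rightarrow> ('y \<Rightarrow> complex) \<Rightarrow> complex" where
  "dual_module_act A \<psi> a = (\<lambda>b. if b \<in> A then \<psi> (\<lambda>y. a y * b y) else 0)"

definition second_dual_act ::
    "('y \<Rightarrow> complex) set \<Rightarrow> ((('y \<Rightarrow> complex) \<Rightarrow> complex) \<Rightarrow> complex)
       \<Rightarrow> (('y \<Rightarrow> complex) \<Rightarrow> complex) \<Rightarrow> ('y \<Rightarrow> complex) \<Rightarrow> complex" where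
  "second_dual_act A F \<psi> = (\<lambda>a. if a \<in> A then F (dual_module_act A \<psi> a) else 0)"

definition arens_product ::
    "('y \<Rightarrow> complex) set \<Rightarrow> (('y \<Rightarrow> complex) \<Rightarrow> real)
       \<Rightarrow> ((('y \<Rightarrow> complex) \<Rightarrow> complex) \<Rightarrow> complex)
       \<Rightarrow> ((('y \<Rightarrow> complex) \<Rightarrow> complex) \<Rightarrow> complex)
       \<Rightarrow> (('y \<Rightarrow> complex) \<Rightarrow> complex) \<Rightarrow> complex" where
  "arens_product A N E F = (\<lambda>\<psi>. if \<psi> \<in> dual A N then E (second_dual_act A F \<psi>) else 0)"

definition ideal_in_second_dual ::
    "('y \<Rightarrow> complex) set \<Rightarrow> (('y \<Rightarrow> complex) \<Rightarrow> real) \<Rightarrow> bool" where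
  "ideal_in_second_dual A N \<longleftrightarrow>
     (\<forall>a\<in>A. \<forall>F\<in>second_dual A N.
        arens_product A N (canonical_embedding A N a) F \<in> canonical_embedding A N ` A \<and>
        arens_product A N F (canonical_embedding A N a) \<in> canonical_embedding A N ` A)"


text \<open>
  The Gel'fand topology on the set of characters is the topology of pointwise convergence on \<open>A\<close>.
  As characters are \<open>0\<close> off \<open>A\<close>, it is the subspace topology inherited from the library topology
  on the function type, which is the product topology. So \<open>continuous_on (characters A)\<close> means
  continuity for the Gel'fand topology.
\<close>

definition characters :: "('y \<Rightarrow> complex) set \<Rightarrow> (('y \<Rightarrow> complex) \<Rightarrow> complex) set" where
  "characters A =
     {\<phi>. linear_functional A \<phi> \<and>
         (\<forall>f\<in>A. \<forall>g\<in>A. \<phi> (\<lambda>y. f y * g y) = \<phi> f * \<phi> g) \<and>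
         (\<exists>f\<in>A. \<phi> f \<noteq> 0)}"

definition bounded_continuous_on_characters ::
    "('y \<Rightarrow> complex) set \<Rightarrow> ((('y \<Rightarrow> complex) \<Rightarrow> complex) \<Rightarrow> complex) set" where
  "bounded_continuous_on_characters A =
     {\<sigma>. (\<forall>\<phi>. \<phi> \<notin> characters A \<longrightarrow> \<sigma> \<phi> = 0) \<and>
         continuous_on (characters A) \<sigma> \<and> bounded (\<sigma> ` characters A)}"

definition multipliers ::
    "('y \<Rightarrow> complex) set \<Rightarrow> (('y \<Rightarrow> complex) \<Rightarrow> 'y \<Rightarrow> complex) set" where
  "multipliers A =
     {T. (\<forall>a\<in>A. T a \<in> A) \<and>
         (\<forall>a\<in>A. \<forall>b\<in>A. T (\<lambda>y. a y + b y) = (\<lambda>y. T a y + T b y)) \<and>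
         (\<forall>c. \<forall>a\<in>A. T (\<lambda>y. c * a y) = (\<lambda>y. c * T a y)) \<and>
         (\<forall>a\<in>A. \<forall>b\<in>A. (\<lambda>y. a y * T b y) = (\<lambda>y. T a y * b y))}"

text \<open>
  A member \<open>\<sigma>\<close> of \<open>multiplier_transforms A\<close> is the transform of \<open>T\<close>: the displayed equation
  determines \<open>\<sigma>\<close> on the characters, since a character does not vanish identically.
\<close>

definition multiplier_transforms ::
    "('y \<Rightarrow> complex) set \<Rightarrow> ((('y \<Rightarrow> complex) \<Rightarrow> complex) \<Rightarrow> complex) set" where
  "multiplier_transforms A =
     {\<sigma> \<in> bounded_continuous_on_characters A.
        \<exists>T\<in>multipliers A. \<forall>a\<in>A. \<forall>\<phi>\<in>characters A. \<phi> (T a) = \<sigma> \<phi> * \<phi> a}"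

definition bse_functions ::
    "('y \<Rightarrow> complex) set \<Rightarrow> (('y \<Rightarrow> complex) \<Rightarrow> real)
       \<Rightarrow> ((('y \<Rightarrow> complex) \<Rightarrow> complex) \<Rightarrow> complex) set" where
  "bse_functions A N =
     {\<sigma> \<in> bounded_continuous_on_characters A.
        \<exists>C>0. \<forall>(m::nat) (\<phi> :: nat \<Rightarrow> ('y \<Rightarrow> complex) \<Rightarrow> complex) (c :: nat \<Rightarrow> complex).
          (\<forall>i<m. \<phi> i \<in> characters A) \<longrightarrow>
          cmod (\<Sum>i<m. c i * \<sigma> (\<phi> i)) \<le> C * dual_norm A N (\<lambda>f. \<Sum>i<m. c i * \<phi> i f)}"

definition bse_algebra :: "('y \<Rightarrow> complex) set \<Rightarrow> (('y \<Rightarrow> complex) \<Rightarrow> real) \<Rightarrow> bool" where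
  "bse_algebra A N \<longleftrightarrow>
     comm_banach_algebra A N \<and> without_order A \<and>
     bse_functions A N = multiplier_transforms A"


definition C0 :: "('x::topological_space \<Rightarrow> complex) set" where
  "C0 = {f. continuous_on UNIV f \<and> (\<forall>e>0. \<exists>K. compact K \<and> (\<forall>x. x \<notin> K \<longrightarrow> cmod (f x) < e))}"

definition banach_function_algebra ::
    "('x::topological_space \<Rightarrow> complex) set \<Rightarrow> (('x \<Rightarrow> complex) \<Rightarrow> real) \<Rightarrow> bool" where
  "banach_function_algebra A N \<longleftrightarrow>
     A \<subseteq> C0 \<and> comm_banach_algebra A N \<and>
     (\<forall>x y. x \<noteq> y \<longrightarrow> (\<exists>f\<in>A. f x \<noteq> f y)) \<and>
     (\<forall>x. \<exists>f\<in>A. f x \<noteq> 0)"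

definition point_evaluation ::
    "('x \<Rightarrow> complex) set \<Rightarrow> 'x \<Rightarrow> ('x \<Rightarrow> complex) \<Rightarrow> complex" where
  "point_evaluation A x = (\<lambda>f. if f \<in> A then f x else 0)"

definition natural_algebra :: "('x::topological_space \<Rightarrow> complex) set \<Rightarrow> bool" where
  "natural_algebra A \<longleftrightarrow>
     (\<exists>p. homeomorphism UNIV (characters A) (point_evaluation A) p)"

text \<open>Regularity is stated on the underlying space, which for a natural algebra is the character space.\<close>

definition regular_algebra :: "('x::topological_space \<Rightarrow> complex) set \<Rightarrow> bool" where
  "regular_algebra A \<longleftrightarrow>
     (\<forall>E x. closed E \<and> x \<notin> E \<longrightarrow> (\<exists>f\<in>A. f x = 1 \<and> (\<forall>y\<in>E. f y = 0)))"

definition compact_support_part ::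
    "('x::topological_space \<Rightarrow> complex) set \<Rightarrow> ('x \<Rightarrow> complex) set" where
  "compact_support_part A = {f\<in>A. compact (closure {x. f x \<noteq> 0})}"

text \<open>
  A net is represented by the filter that its tails generate on the algebra. The net is bounded
  by \<open>C\<close> and contained in \<open>B\<close>, which says that the filter lives on \<open>{e \<in> B. N e \<le> C}\<close>.
\<close>

definition has_bounded_approximate_identity_in ::
    "('x \<Rightarrow> complex) set \<Rightarrow> (('x \<Rightarrow> complex) \<Rightarrow> real) \<Rightarrow> ('x \<Rightarrow> complex) set \<Rightarrow> bool" where
  "has_bounded_approximate_identity_in A N B \<longleftrightarrow>
     (\<exists>(F :: ('x \<Rightarrow> complex) filter) C.
        F \<noteq> bot \<and> F \<le> principal {e \<in> B. N e \<le> C} \<and>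
        (\<forall>f\<in>A. ((\<lambda>e. N (\<lambda>x. f x * e x - f x)) \<longlongrightarrow> 0) F))"

definition local_functions ::
    "('x::topological_space \<Rightarrow> complex) set \<Rightarrow> ('x \<Rightarrow> complex) set" where
  "local_functions A =
     {\<sigma>. continuous_on UNIV \<sigma> \<and> (\<forall>f\<in>compact_support_part A. (\<lambda>x. f x * \<sigma> x) \<in> A)}"

definition weighted_algebra ::
    "('x \<Rightarrow> complex) set \<Rightarrow> ('x \<Rightarrow> complex) \<Rightarrow> nat \<Rightarrow> ('x \<Rightarrow> complex) set" where
  "weighted_algebra A \<tau> n = {f\<in>A. \<forall>k\<le>n. (\<lambda>x. f x * \<tau> x ^ k) \<in> A}"

definition weighted_norm ::
    "(('x \<Rightarrow> complex) \<Rightarrow> real) \<Rightarrow> ('x \<Rightarrow> complex) \<Rightarrow> nat \<Rightarrow> ('x \<Rightarrow> complex) \<Rightarrow> real" where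
  "weighted_norm N \<tau> n f = (\<Sum>k\<le>n. N (\<lambda>x. f x * \<tau> x ^ k))"

end

theory Submission
  imports Defs
begin

text \<open>
  A BSE-function \<open>\<sigma>\<close> is a bounded functional on the span of the characters, so by Hahn--Banach it
  comes from some \<open>\<Phi> \<in> A\<^sup>*\<^sup>*\<close>. As \<open>A\<close> is an ideal in \<open>A\<^sup>*\<^sup>*\<close>, the product \<open>\<Phi> a\<close> lies in \<open>A\<close>,
  and its Gel'fand transform is that of \<open>a\<close> times \<open>\<sigma>\<close>; hence \<open>\<sigma>\<close> is a multiplier. Conversely, a
  multiplier \<open>T\<close> is bounded on a bounded approximate identity \<open>(e)\<close>, and
  \<open>\<Sum> c\<^sub>i \<sigma>(\<phi>\<^sub>i)\<close> is the limit of \<open>(\<Sum> c\<^sub>i \<phi>\<^sub>i)(T e)\<close>.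
\<close>

section \<open>The Hahn--Banach theorem on a carrier\<close>

text \<open>Characters are defined algebraically, so their continuity has to be earned: completeness
  provides quasi-inverses, and these force norm at most 1. Hence combinations of characters lie in
  the dual. The dual again consists of complex-valued functions, so the same extension theorem
  applies with the dual as carrier and produces elements of the second dual. The basic structure
  carries a seminorm because uniform boundedness is applied to the maps \<open>f\<close> \<mapsto>
  \<open>N (T e \<cdot> f)\<close>, which may vanish at a nonzero \<open>f\<close>. The return from
  characters to functions rests on naturality: every character is an evaluation, so an element of
  \<open>A\<close> whose transform is that of \<open>a\<close> times \<sigma> must be the product of
  \<open>a\<close> with \<open>\<lambda>x. \<sigma> (point_evaluation A x)\<close>.\<close>

locale seminormed_space =
  fixes V :: "('y \<Rightarrow> complex) set" and p :: "('y \<Rightarrow> complex) \<Rightarrow> real"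
  assumes subspace: "complex_subspace V"
    and seminorm_add: "\<lbrakk>f \<in> V; g \<in> V\<rbrakk> \<Longrightarrow> p (\<lambda>y. f y + g y) \<le> p f + p g"
    and seminorm_scale: "f \<in> V \<Longrightarrow> p (\<lambda>y. c * f y) = cmod c * p f"
begin

lemma zero_mem: "(\<lambda>_. 0) \<in> V"
  and add_mem: "\<lbrakk>f \<in> V; g \<in> V\<rbrakk> \<Longrightarrow> (\<lambda>y. f y + g y) \<in> V"
  and scale_mem: "f \<in> V \<Longrightarrow> (\<lambda>y. c * f y) \<in> V"
  using subspace by (auto simp: complex_subspace_def)

lemma minus_mem: "f \<in> V \<Longrightarrow> (\<lambda>y. - f y) \<in> V"
  using scale_mem[of f "-1"] by simp

lemma diff_mem: "\<lbrakk>f \<in> V; g \<in> V\<rbrakk> \<Longrightarrow> (\<lambda>y. f y - g y) \<in> V"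
  using add_mem[OF _ minus_mem, of f g] by simp

lemma sum_mem: "(\<And>i. i \<in> I \<Longrightarrow> h i \<in> V) \<Longrightarrow> (\<lambda>y. \<Sum>i\<in>I. c i * h i y) \<in> V"
  by (induction I rule: infinite_finite_induct) (auto intro!: zero_mem add_mem scale_mem)

lemma seminorm_zero: "p (\<lambda>_. 0) = 0"
  using seminorm_scale[OF zero_mem, of 0] by simp

lemma seminorm_minus: "f \<in> V \<Longrightarrow> p (\<lambda>y. - f y) = p f"
  using seminorm_scale[of f "-1"] by simp

lemma seminorm_nonneg:
  assumes "f \<in> V" shows "0 \<le> p f"
  using seminorm_add[OF assms minus_mem[OF assms]] seminorm_minus[OF assms] seminorm_zero by simp

lemma seminorm_diff_commute:
  assumes "f \<in> V" "g \<in> V" shows "p (\<lambda>y. f y - g y) = p (\<lambda>y. g y - f y)"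
  using seminorm_minus[OF diff_mem[OF assms]] by simp

lemma seminorm_diff_triangle:
  assumes "f \<in> V" "g \<in> V" "h \<in> V"
  shows "p (\<lambda>y. f y - h y) \<le> p (\<lambda>y. f y - g y) + p (\<lambda>y. g y - h y)"
  using seminorm_add[OF diff_mem[OF assms(1,2)] diff_mem[OF assms(2,3)]] by simp

end

section \<open>Sublinear functionals and their minimal elements\<close>

definition sublinear_on :: "('y \<Rightarrow> complex) set \<Rightarrow> (('y \<Rightarrow> complex) \<Rightarrow> real) \<Rightarrow> bool" where
  "sublinear_on V q \<longleftrightarrow>
     (\<forall>f\<in>V. \<forall>g\<in>V. q (\<lambda>y. f y + g y) \<le> q f + q g) \<and>
     (\<forall>f\<in>V. \<forall>t>0. q (\<lambda>y. complex_of_real t * f y) \<le> t * q f)"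

context
  fixes V :: "('y \<Rightarrow> complex) set"
  assumes V: "complex_subspace V"
begin

lemma complex_subspace_mem:
  "(\<lambda>_. 0) \<in> V" "\<lbrakk>f \<in> V; g \<in> V\<rbrakk> \<Longrightarrow> (\<lambda>y. f y + g y) \<in> V" "f \<in> V \<Longrightarrow> (\<lambda>y. c * f y) \<in> V"
  "f \<in> V \<Longrightarrow> (\<lambda>y. - f y) \<in> V"
proof -
  show "(\<lambda>y. - f y) \<in> V" if "f \<in> V"
  proof -
    have "(\<lambda>y. (-1) * f y) \<in> V" using V that unfolding complex_subspace_def by blast
    then show ?thesis by simp
  qed
qed (use V in \<open>auto simp: complex_subspace_def\<close>)

lemma sublinear_on_add:
  "\<lbrakk>sublinear_on V q; f \<in> V; g \<in> V\<rbrakk> \<Longrightarrow> q (\<lambda>y. f y + g y) \<le> q f + q g"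
  and sublinear_on_scale_le:
  "\<lbrakk>sublinear_on V q; f \<in> V; t > 0\<rbrakk> \<Longrightarrow> q (\<lambda>y. complex_of_real t * f y) \<le> t * q f"
  by (simp_all add: sublinear_on_def)

text \<open>The factor 2 forces \<open>q 0\<close> to be nonnegative, the factor 1/2 forces it to be
  nonpositive.\<close>

lemma sublinear_on_zero:
  assumes "sublinear_on V q" shows "q (\<lambda>_. 0) = 0"
  using sublinear_on_scale_le[OF assms complex_subspace_mem(1), of 2]
    sublinear_on_scale_le[OF assms complex_subspace_mem(1), of "1/2"] by simp

text \<open>The inequality for 1/t, applied to the scaled function, is the converse one. Hence
  sublinearity can be defined by a one-sided condition, which passes to infima more easily than an
  equation.\<close>

lemma sublinear_on_scale:
  assumes q: "sublinear_on V q" and f: "f \<in> V" and t: "t > 0"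
  shows "q (\<lambda>y. complex_of_real t * f y) = t * q f"
proof (rule antisym)
  show "q (\<lambda>y. complex_of_real t * f y) \<le> t * q f"
    by (rule sublinear_on_scale_le[OF q f t])
  have "q (\<lambda>y. complex_of_real (1/t) * (complex_of_real t * f y))
      \<le> (1/t) * q (\<lambda>y. complex_of_real t * f y)"
    using t by (intro sublinear_on_scale_le[OF q complex_subspace_mem(3)[OF f]]) simp
  then show "t * q f \<le> q (\<lambda>y. complex_of_real t * f y)"
    using t by (simp add: field_simps)
qed

lemma sublinear_on_neg_le:
  assumes q: "sublinear_on V q" and f: "f \<in> V"
  shows "- q (\<lambda>y. - f y) \<le> q f"
  using sublinear_on_add[OF q f complex_subspace_mem(4)[OF f]] sublinear_on_zero[OF q] by simp

text \<open>By minimality, lowering \<open>q\<close> along the direction of \<open>x\<close> does not change it.\<close>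

lemma minimal_sublinear_additive:
  assumes q: "sublinear_on V q" and off: "\<And>f. f \<notin> V \<Longrightarrow> q f = 0"
    and min: "\<And>r. \<lbrakk>sublinear_on V r; \<And>f. f \<notin> V \<Longrightarrow> r f = 0; \<And>f. r f \<le> q f\<rbrakk> \<Longrightarrow> r = q"
    and f: "f \<in> V" and x: "x \<in> V"
  shows "q (\<lambda>y. f y + x y) = q f + q x"
proof -
  \<comment> \<open>The infimum \<open>r\<close> is sublinear and lies below \<open>q\<close> (take
    t = 0), so minimality gives \<open>r = q\<close>. Then t = 1 yields the missing inequality
    \<open>q f + q x \<le> q (f + x)\<close>.\<close>
  define h where "h f t = q (\<lambda>y. f y + complex_of_real t * x y) - t * q x" for f t
  define r where "r f = (if f \<in> V then INF t\<in>{0..}. h f t else 0)" for f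
  have qadd: "q (\<lambda>y. f y + g y) \<le> q f + q g" if "f \<in> V" "g \<in> V" for f g
    using q that by (simp add: sublinear_on_def)
  have qscale: "q (\<lambda>y. complex_of_real t * f y) = t * q f" if "f \<in> V" "t \<ge> 0" for f t
    using sublinear_on_scale[OF q, of f t] sublinear_on_zero[OF q] that by (cases "t = 0") auto
  \<comment> \<open>The bound does not depend on t: subadditivity gives
    \<open>t * q x = q (t x) \<le> q (f + t x) + q (- f)\<close>. So the infimum is finite.\<close>
  have lower: "- q (\<lambda>y. - f y) \<le> h f t" if "f \<in> V" "t \<ge> 0" for f t
  proof -
    have "q (\<lambda>y. (f y + complex_of_real t * x y) + - f y)
        \<le> q (\<lambda>y. f y + complex_of_real t * x y) + q (\<lambda>y. - f y)"
      by (rule qadd) (auto intro!: complex_subspace_mem that x)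
    then show ?thesis using qscale[OF x \<open>t \<ge> 0\<close>] by (simp add: h_def)
  qed
  have bdd: "bdd_below (h f ` {0..})" if "f \<in> V" for f
    using lower[OF that] by (intro bdd_belowI[of _ "- q (\<lambda>y. - f y)"]) auto
  have r_le: "r f \<le> h f t" if "f \<in> V" "t \<ge> 0" for f t
    using that by (auto simp: r_def intro: cINF_lower bdd)
  have r_ge: "b \<le> r f" if "f \<in> V" "\<And>t. t \<ge> 0 \<Longrightarrow> b \<le> h f t" for f b
    using that by (auto simp: r_def intro!: cINF_greatest)
  have r_le_q: "r f \<le> q f" for f
    using r_le[of f 0] off[of f] by (cases "f \<in> V") (auto simp: h_def r_def)
  have "sublinear_on V r"
    unfolding sublinear_on_def
  proof (intro conjI ballI allI impI)
    fix f g assume fg: "f \<in> V" "g \<in> V"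
    \<comment> \<open>The parameters add: \<open>h (f + g) (s + t) \<le> h f s + h g t\<close>. As s
      and t are independent, the two infima can then be taken one after the other.\<close>
    have *: "r (\<lambda>y. f y + g y) \<le> h f s + h g t" if "s \<ge> 0" "t \<ge> 0" for s t
    proof -
      have "q (\<lambda>y. (f y + complex_of_real s * x y) + (g y + complex_of_real t * x y))
          \<le> q (\<lambda>y. f y + complex_of_real s * x y) + q (\<lambda>y. g y + complex_of_real t * x y)"
        by (intro qadd complex_subspace_mem fg x)
      then have "h (\<lambda>y. f y + g y) (s + t) \<le> h f s + h g t"
        by (simp add: h_def algebra_simps)
      with r_le[OF complex_subspace_mem(2)[OF fg], of "s + t"] that show ?thesis by simp
    qed
    have **: "r (\<lambda>y. f y + g y) - h f s \<le> r g" if "s \<ge> 0" for s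
    proof (rule r_ge[OF fg(2)])
      show "r (\<lambda>y. f y + g y) - h f s \<le> h g t" if "t \<ge> 0" for t
        using *[OF \<open>s \<ge> 0\<close> that] by linarith
    qed
    have "r (\<lambda>y. f y + g y) - r g \<le> r f"
    proof (rule r_ge[OF fg(1)])
      show "r (\<lambda>y. f y + g y) - r g \<le> h f s" if "s \<ge> 0" for s
        using **[OF that] by linarith
    qed
    then show "r (\<lambda>y. f y + g y) \<le> r f + r g" by simp
  next
    fix f and t :: real assume f: "f \<in> V" and t: "t > 0"
    have "r (\<lambda>y. complex_of_real t * f y) / t \<le> r f"
    proof (rule r_ge[OF f])
      fix s :: real assume s: "s \<ge> 0"
      have "q (\<lambda>y. complex_of_real t * (f y + complex_of_real s * x y))
          = t * q (\<lambda>y. f y + complex_of_real s * x y)"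
        using t by (intro qscale complex_subspace_mem f x) auto
      then have "h (\<lambda>y. complex_of_real t * f y) (t * s) = t * h f s"
        by (simp add: h_def algebra_simps)
      with r_le[OF complex_subspace_mem(3)[OF f], of "t * s" "complex_of_real t"] s t
      show "r (\<lambda>y. complex_of_real t * f y) / t \<le> h f s" by (simp add: field_simps)
    qed
    then show "r (\<lambda>y. complex_of_real t * f y) \<le> t * r f"
      using t by (simp add: field_simps)
  qed
  then have "r = q" using r_le_q by (intro min) (auto simp: r_def)
  with r_le[OF f, of 1] have "q f + q x \<le> q (\<lambda>y. f y + x y)" by (simp add: h_def)
  with qadd[OF f x] show ?thesis by simp
qed

text \<open>Zorn's lemma among the sublinear functionals below \<open>p\<close>; a chain is bounded
  by its pointwise infimum. With all values off \<open>V\<close> equal to 0, comparing on the whole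
  type amounts to comparing on \<open>V\<close>, and minimality gives an equality of
  functions.\<close>

lemma minimal_sublinear_exists:
  assumes p: "sublinear_on V p"
  obtains q where "sublinear_on V q" "\<And>f. f \<notin> V \<Longrightarrow> q f = 0" "\<And>f. f \<in> V \<Longrightarrow> q f \<le> p f"
    "\<And>r. \<lbrakk>sublinear_on V r; \<And>f. f \<notin> V \<Longrightarrow> r f = 0; \<And>f. r f \<le> q f\<rbrakk> \<Longrightarrow> r = q"
proof -
  define S where
    "S = {q. sublinear_on V q \<and> (\<forall>f. f \<notin> V \<longrightarrow> q f = 0) \<and> (\<forall>f\<in>V. q f \<le> p f)}"
  \<comment> \<open>The order is reversed, so that a maximal element for \<open>P\<close> is a
    minimal functional.\<close>
  define P :: "(('y \<Rightarrow> complex) \<Rightarrow> real) \<Rightarrow> (('y \<Rightarrow> complex) \<Rightarrow> real) \<Rightarrow> bool"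
    where "P a b \<longleftrightarrow> (\<forall>f. b f \<le> a f)" for a b
  have "\<exists>m\<in>S. \<forall>a\<in>S. P m a \<longrightarrow> a = m"
  proof (rule predicate_Zorn)
    show "partial_order_on S (relation_of P S)"
      unfolding partial_order_on_def preorder_on_def
      by (auto simp: relation_of_def P_def refl_on_def trans_def antisym_def
          intro: order_trans intro!: ext antisym)
  next
    fix C assume C: "C \<in> Chains (relation_of P S)"
    have CS: "a \<in> S" if "a \<in> C" for a
      using C that by (auto simp: Chains_def relation_of_def)
    have comp: "P a b \<or> P b a" if "a \<in> C" "b \<in> C" for a b
      using C that by (auto simp: Chains_def relation_of_def)
    show "\<exists>u\<in>S. \<forall>a\<in>C. P a u"
    proof (cases "C = {}")
      case True
      \<comment> \<open>The empty chain needs a bound as well: \<open>p\<close>, cut off outside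
        \<open>V\<close>.\<close>
      have "sublinear_on V (\<lambda>f. if f \<in> V then p f else 0)"
        using p complex_subspace_mem by (simp add: sublinear_on_def)
      then have "(\<lambda>f. if f \<in> V then p f else 0) \<in> S"
        by (simp add: S_def)
      with True show ?thesis by blast
    next
      case False
      define u where "u f = (INF a\<in>C. a f)" for f
      \<comment> \<open>On \<open>V\<close> one has
        \<open>a f \<ge> - a (- f) \<ge> - p (- f)\<close>, uniformly over the chain; the minimum
        with 0 covers functions off \<open>V\<close>.\<close>
      have lower: "min 0 (- p (\<lambda>y. - f y)) \<le> a f" if "a \<in> C" for a f
      proof (cases "f \<in> V")
        case True
        have "a (\<lambda>y. - f y) \<le> p (\<lambda>y. - f y)"
          using CS[OF that] complex_subspace_mem(4)[OF True] by (simp add: S_def)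
        with sublinear_on_neg_le[of a f] CS[OF that] True show ?thesis by (simp add: S_def)
      next
        case False then show ?thesis using CS[OF that] by (simp add: S_def)
      qed
      have bdd: "bdd_below ((\<lambda>a. a f) ` C)" for f
        using lower by (intro bdd_belowI[of _ "min 0 (- p (\<lambda>y. - f y))"]) auto
      have u_le: "u f \<le> a f" if "a \<in> C" for a f
        using that by (auto simp: u_def intro: cINF_lower bdd)
      have u_ge: "b \<le> u f" if "\<And>a. a \<in> C \<Longrightarrow> b \<le> a f" for f b
        using that False by (auto simp: u_def intro!: cINF_greatest)
      have "sublinear_on V u"
        unfolding sublinear_on_def
      proof (intro conjI ballI allI impI)
        fix f g assume fg: "f \<in> V" "g \<in> V"
        have *: "u (\<lambda>y. f y + g y) \<le> a f + b g" if ab: "a \<in> C" "b \<in> C" for a b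
        proof -
          \<comment> \<open>The smaller of the two comparable functionals serves for both
            \<open>f\<close> and \<open>g\<close>.\<close>
          obtain c where c: "c \<in> C" "c f \<le> a f" "c g \<le> b g"
            using comp[OF ab] ab by (auto simp: P_def)
          have "c (\<lambda>y. f y + g y) \<le> c f + c g"
            using CS[OF c(1)] fg by (simp add: S_def sublinear_on_def)
          with u_le[OF c(1), of "\<lambda>y. f y + g y"] c(2,3) show ?thesis by linarith
        qed
        have **: "u (\<lambda>y. f y + g y) - a f \<le> u g" if "a \<in> C" for a
        proof (rule u_ge)
          show "u (\<lambda>y. f y + g y) - a f \<le> b g" if "b \<in> C" for b
            using *[OF \<open>a \<in> C\<close> that] by linarith
        qed
        have "u (\<lambda>y. f y + g y) - u g \<le> u f"
        proof (rule u_ge)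
          show "u (\<lambda>y. f y + g y) - u g \<le> a f" if "a \<in> C" for a
            using **[OF that] by linarith
        qed
        then show "u (\<lambda>y. f y + g y) \<le> u f + u g" by simp
      next
        fix f and t :: real assume f: "f \<in> V" and t: "t > 0"
        have "u (\<lambda>y. complex_of_real t * f y) / t \<le> u f"
        proof (rule u_ge)
          fix a assume a: "a \<in> C"
          have "a (\<lambda>y. complex_of_real t * f y) \<le> t * a f"
            using CS[OF a] f t by (simp add: S_def sublinear_on_def)
          with u_le[OF a, of "\<lambda>y. complex_of_real t * f y"] t
          show "u (\<lambda>y. complex_of_real t * f y) / t \<le> a f" by (simp add: field_simps)
        qed
        then show "u (\<lambda>y. complex_of_real t * f y) \<le> t * u f"
          using t by (simp add: field_simps)
      qed
      moreover have "u f = 0" if "f \<notin> V" for f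
      proof -
        have "a f = 0" if "a \<in> C" for a
          using CS[OF that] \<open>f \<notin> V\<close> by (simp add: S_def)
        then have "(\<lambda>a. a f) ` C = (\<lambda>_. 0) ` C" by (intro image_cong) auto
        then show ?thesis using False by (simp add: u_def)
      qed
      moreover have "u f \<le> p f" if "f \<in> V" for f
      proof -
        obtain a where "a \<in> C" using False by blast
        with u_le[of a f] CS[of a] that show ?thesis by (auto simp: S_def intro: order_trans)
      qed
      ultimately have "u \<in> S" by (simp add: S_def)
      then show ?thesis using u_le by (auto simp: P_def)
    qed
  qed
  then obtain q where q: "q \<in> S" and min: "\<And>a. a \<in> S \<Longrightarrow> P q a \<Longrightarrow> a = q" by blast
  show thesis
  proof (rule that)
    show "sublinear_on V q" "\<And>f. f \<notin> V \<Longrightarrow> q f = 0" "\<And>f. f \<in> V \<Longrightarrow> q f \<le> p f"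
      using q by (auto simp: S_def)
    show "r = q" if "sublinear_on V r" "\<And>f. f \<notin> V \<Longrightarrow> r f = 0" "\<And>f. r f \<le> q f" for r
      using that q by (intro min) (auto simp: S_def P_def, meson order_trans)
  qed
qed

end

text \<open>The extension problem is posed for the graph \<open>R\<close> of the functional, so that the bound
  takes care of well-definedness.\<close>

lemma (in seminormed_space) hahn_banach:
  fixes R :: "(('y \<Rightarrow> complex) \<times> complex) set"
  assumes R_V: "\<And>s r. (s, r) \<in> R \<Longrightarrow> s \<in> V"
    and R_zero: "((\<lambda>_. 0), 0) \<in> R"
    and R_add: "\<And>s r s' r'. \<lbrakk>(s, r) \<in> R; (s', r') \<in> R\<rbrakk> \<Longrightarrow> ((\<lambda>y. s y + s' y), r + r') \<in> R"
    and R_scale: "\<And>c s r. (s, r) \<in> R \<Longrightarrow> ((\<lambda>y. c * s y), c * r) \<in> R"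
    and R_bound: "\<And>s r. (s, r) \<in> R \<Longrightarrow> cmod r \<le> C * p s"
    and C: "C \<ge> 0"
  obtains \<Phi> where "linear_functional V \<Phi>" "\<And>f. f \<in> V \<Longrightarrow> cmod (\<Phi> f) \<le> 2 * C * p f"
    "\<And>s r. (s, r) \<in> R \<Longrightarrow> \<Phi> s = r"
proof -
  \<comment> \<open>The infimum \<open>P\<close> encodes both requirements in one sublinear
    functional. A functional \<open>u\<close> below \<open>P\<close> satisfies
    \<open>u f \<le> C * p f\<close>, by the pair (0, 0), and \<open>u s \<le> Re r\<close> for
    every pair (s, r) in \<open>R\<close>.\<close>
  define k where "k f z = C * p (\<lambda>y. f y - fst z y) + Re (snd z)"
    for f and z :: "('y \<Rightarrow> complex) \<times> complex"
  define P where "P f = (INF z\<in>R. k f z)" for f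
  \<comment> \<open>Here the hypothesis \<open>R_bound\<close> enters:
    \<open>- Re r \<le> C * p s \<le> C * p f + C * p (f - s)\<close>.\<close>
  have lower: "- C * p f \<le> k f z" if "f \<in> V" "z \<in> R" for f z
  proof -
    obtain s r where z: "z = (s, r)" by (cases z)
    have s: "s \<in> V" using that z R_V by blast
    have "p (\<lambda>y. f y + - (f y - s y)) \<le> p f + p (\<lambda>y. - (f y - s y))"
      by (intro seminorm_add that minus_mem diff_mem s)
    also have "p (\<lambda>y. - (f y - s y)) = p (\<lambda>y. f y - s y)"
      by (intro seminorm_minus diff_mem that s)
    finally have "C * p s \<le> C * p f + C * p (\<lambda>y. f y - s y)"
      using C by (simp flip: distrib_left add: mult_left_mono)
    moreover have "cmod r \<le> C * p s" using R_bound that z by blast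
    moreover have "- Re r \<le> cmod r" using abs_Re_le_cmod[of r] by linarith
    ultimately show ?thesis by (simp add: k_def z)
  qed
  have bdd: "bdd_below (k f ` R)" if "f \<in> V" for f
    using lower[OF that] by (intro bdd_belowI[of _ "- C * p f"]) auto
  have P_le: "P f \<le> k f z" if "f \<in> V" "z \<in> R" for f z
    using that by (auto simp: P_def intro: cINF_lower bdd)
  have P_ge: "b \<le> P f" if "f \<in> V" "\<And>z. z \<in> R \<Longrightarrow> b \<le> k f z" for f b
    using that R_zero by (auto simp: P_def intro!: cINF_greatest)
  have "sublinear_on V P"
    unfolding sublinear_on_def
  proof (intro conjI ballI allI impI)
    fix f g assume fg: "f \<in> V" "g \<in> V"
    have *: "P (\<lambda>y. f y + g y) \<le> k f z + k g w" if "z \<in> R" "w \<in> R" for z w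
    proof -
      obtain s r s' r' where z: "z = (s, r)" and w: "w = (s', r')" by (cases z, cases w)
      have s: "s \<in> V" "s' \<in> V" using that z w R_V by blast+
      have "p (\<lambda>y. (f y - s y) + (g y - s' y)) \<le> p (\<lambda>y. f y - s y) + p (\<lambda>y. g y - s' y)"
        by (intro seminorm_add diff_mem fg s)
      then have "C * p (\<lambda>y. (f y - s y) + (g y - s' y))
          \<le> C * p (\<lambda>y. f y - s y) + C * p (\<lambda>y. g y - s' y)"
        using C by (simp flip: distrib_left add: mult_left_mono)
      moreover have "(\<lambda>y. (f y - s y) + (g y - s' y)) = (\<lambda>y. f y + g y - (s y + s' y))"
        by (simp add: algebra_simps)
      ultimately have "k (\<lambda>y. f y + g y) ((\<lambda>y. s y + s' y), r + r') \<le> k f z + k g w"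
        by (simp add: k_def z w)
      with P_le[OF add_mem[OF fg] R_add[of s r s' r']] that z w show ?thesis by force
    qed
    have **: "P (\<lambda>y. f y + g y) - k f z \<le> P g" if "z \<in> R" for z
    proof (rule P_ge[OF fg(2)])
      show "P (\<lambda>y. f y + g y) - k f z \<le> k g w" if "w \<in> R" for w
        using *[OF \<open>z \<in> R\<close> that] by linarith
    qed
    have "P (\<lambda>y. f y + g y) - P g \<le> P f"
    proof (rule P_ge[OF fg(1)])
      show "P (\<lambda>y. f y + g y) - P g \<le> k f z" if "z \<in> R" for z
        using **[OF that] by linarith
    qed
    then show "P (\<lambda>y. f y + g y) \<le> P f + P g" by simp
  next
    fix f and t :: real assume f: "f \<in> V" and t: "t > 0"
    have "P (\<lambda>y. complex_of_real t * f y) / t \<le> P f"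
    proof (rule P_ge[OF f])
      fix z assume z: "z \<in> R"
      obtain s r where zz: "z = (s, r)" by (cases z)
      have s: "s \<in> V" using z zz R_V by blast
      have "p (\<lambda>y. complex_of_real t * (f y - s y)) = t * p (\<lambda>y. f y - s y)"
        using seminorm_scale[OF diff_mem[OF f s], of "complex_of_real t"] t by simp
      then have "k (\<lambda>y. complex_of_real t * f y) ((\<lambda>y. complex_of_real t * s y), complex_of_real t * r) = t * k f z"
        by (simp add: k_def zz algebra_simps)
      with P_le[OF scale_mem[OF f] R_scale[of s r "complex_of_real t"], of "complex_of_real t"] z zz t
      show "P (\<lambda>y. complex_of_real t * f y) / t \<le> k f z" by (simp add: field_simps)
    qed
    then show "P (\<lambda>y. complex_of_real t * f y) \<le> t * P f"
      using t by (simp add: field_simps)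
  qed
  then obtain u where u: "sublinear_on V u" "\<And>f. f \<notin> V \<Longrightarrow> u f = 0" "\<And>f. f \<in> V \<Longrightarrow> u f \<le> P f"
    "\<And>r. \<lbrakk>sublinear_on V r; \<And>f. f \<notin> V \<Longrightarrow> r f = 0; \<And>f. r f \<le> u f\<rbrakk> \<Longrightarrow> r = u"
    using minimal_sublinear_exists[OF subspace] by metis
  have u_add: "u (\<lambda>y. f y + g y) = u f + u g" if "f \<in> V" "g \<in> V" for f g
    by (rule minimal_sublinear_additive[OF subspace u(1,2,4) that])
  have u_neg: "u (\<lambda>y. - f y) = - u f" if "f \<in> V" for f
    using u_add[OF that minus_mem[OF that]] sublinear_on_zero[OF subspace u(1)] by simp
  have u_real: "u (\<lambda>y. complex_of_real t * f y) = t * u f" if "f \<in> V" for f t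
  proof (cases t "0::real" rule: linorder_cases)
    case less
    have "u (\<lambda>y. - (complex_of_real (- t) * f y)) = - u (\<lambda>y. complex_of_real (- t) * f y)"
      by (intro u_neg scale_mem that)
    then show ?thesis using sublinear_on_scale[OF subspace u(1) that, of "- t"] less by simp
  next
    case equal
    then show ?thesis using sublinear_on_zero[OF subspace u(1)] by simp
  next
    case greater
    then show ?thesis using sublinear_on_scale[OF subspace u(1) that] by simp
  qed
  have u_le: "u f \<le> C * p f" if "f \<in> V" for f
    using u(3)[OF that] P_le[OF that R_zero] by (simp add: k_def)
  have u_abs: "\<bar>u f\<bar> \<le> C * p f" if "f \<in> V" for f
    using u_le[OF that] u_le[OF minus_mem[OF that]] u_neg[OF that] seminorm_minus[OF that] by simp
  have u_R_le: "u s \<le> Re r" if "(s, r) \<in> R" for s r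
    using u(3)[OF R_V[OF that]] P_le[OF R_V[OF that] that] seminorm_zero by (simp add: k_def)
  \<comment> \<open>The reverse inequality comes from the pair (-s, -r), which also belongs to
    \<open>R\<close>.\<close>
  have u_R: "u s = Re r" if "(s, r) \<in> R" for s r
    using u_R_le[OF that] u_R_le[OF R_scale[OF that, of "-1"]] u_neg[OF R_V[OF that]] by simp
  \<comment> \<open>The real-linear \<open>u\<close> is the real part of exactly one complex-linear
    functional, \<open>u f - \<i> * u (\<i> f)\<close>.\<close>
  define \<Phi> where "\<Phi> f = Complex (u f) (- u (\<lambda>y. \<i> * f y))" for f
  have lin: "linear_functional V \<Phi>"
    unfolding linear_functional_def
  proof (intro conjI allI impI ballI)
    fix f assume "f \<notin> V"
    moreover from this have "(\<lambda>y. \<i> * f y) \<notin> V" using scale_mem[of "\<lambda>y. \<i> * f y" "-\<i>"] by auto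
    ultimately show "\<Phi> f = 0" using u(2) by (simp add: \<Phi>_def Complex_eq_0)
  next
    fix f g assume fg: "f \<in> V" "g \<in> V"
    then show "\<Phi> (\<lambda>y. f y + g y) = \<Phi> f + \<Phi> g"
      using u_add[OF fg] u_add[OF scale_mem[OF fg(1)] scale_mem[OF fg(2)], of \<i> \<i>]
      by (simp add: \<Phi>_def distrib_left complex_eq_iff)
  next
    fix c f assume f: "f \<in> V"
    define a b where "a = Re c" and "b = Im c"
    have c: "c = complex_of_real a + complex_of_real b * \<i>"
      by (simp add: a_def b_def complex_eq_iff)
    have f': "(\<lambda>y. \<i> * f y) \<in> V" using scale_mem[OF f] .
    have "u (\<lambda>y. complex_of_real a * f y + complex_of_real b * (\<i> * f y)) = a * u f + b * u (\<lambda>y. \<i> * f y)"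
      using u_add[OF scale_mem[OF f] scale_mem[OF f']] u_real[OF f] u_real[OF f'] by simp
    then have 1: "u (\<lambda>y. c * f y) = a * u f + b * u (\<lambda>y. \<i> * f y)"
      by (simp add: c algebra_simps)
    have "u (\<lambda>y. complex_of_real a * (\<i> * f y) + complex_of_real (-b) * f y)
        = a * u (\<lambda>y. \<i> * f y) + (- b) * u f"
      using u_add[OF scale_mem[OF f'] scale_mem[OF f]] u_real[OF f, of "-b"] u_real[OF f', of a] by metis
    moreover have "(\<lambda>y. complex_of_real a * (\<i> * f y) + complex_of_real (-b) * f y) = (\<lambda>y. \<i> * (c * f y))"
      by (auto simp: c algebra_simps)
    ultimately have 2: "u (\<lambda>y. \<i> * (c * f y)) = a * u (\<lambda>y. \<i> * f y) - b * u f" by simp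
    show "\<Phi> (\<lambda>y. c * f y) = c * \<Phi> f"
      by (simp add: \<Phi>_def 1 2 complex_eq_iff a_def b_def algebra_simps)
  qed
  show thesis
  proof (rule that[OF lin])
    \<comment> \<open>The factor 2 comes from estimating the modulus by the sum of the absolute
      values of the real and imaginary parts, each at most \<open>C * p f\<close>.\<close>
    show "cmod (\<Phi> f) \<le> 2 * C * p f" if "f \<in> V" for f
      using cmod_le[of "\<Phi> f"] u_abs[OF that] u_abs[OF scale_mem[OF that, of \<i>]]
        seminorm_scale[OF that, of \<i>] by (simp add: \<Phi>_def)
    show "\<Phi> s = r" if "(s, r) \<in> R" for s r
      using u_R[OF that] u_R[OF R_scale[OF that, of \<i>]] by (simp add: \<Phi>_def complex_eq_iff)
  qed
qed


section \<open>Banach spaces on a carrier\<close>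

locale normed_carrier =
  fixes V :: "('y \<Rightarrow> complex) set" and N :: "('y \<Rightarrow> complex) \<Rightarrow> real"
  assumes V_subspace: "complex_subspace V" and V_norm: "norm_on V N"
begin

sublocale seminormed_space V N
  using V_subspace V_norm by unfold_locales (auto simp: norm_on_def)

lemma norm_eq_zero_iff: "f \<in> V \<Longrightarrow> N f = 0 \<longleftrightarrow> f = (\<lambda>_. 0)"
  using V_norm by (simp add: norm_on_def)

text \<open>The value 0 off the carrier keeps the distance nonnegative and symmetric on the whole
  type, as \<open>Metric_space\<close> demands.\<close>

definition norm_dist :: "('y \<Rightarrow> complex) \<Rightarrow> ('y \<Rightarrow> complex) \<Rightarrow> real" where
  "norm_dist f g = (if f \<in> V \<and> g \<in> V then N (\<lambda>y. f y - g y) else 0)"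

sublocale metric: Metric_space V norm_dist
proof
  fix f g h
  show "0 \<le> norm_dist f g" by (simp add: norm_dist_def seminorm_nonneg diff_mem)
  show "norm_dist f g = norm_dist g f" by (auto simp: norm_dist_def intro: seminorm_diff_commute)
  show "norm_dist f g = 0 \<longleftrightarrow> f = g" if "f \<in> V" "g \<in> V"
    using that norm_eq_zero_iff[OF diff_mem[OF that]] by (auto simp: norm_dist_def fun_eq_iff)
  show "norm_dist f h \<le> norm_dist f g + norm_dist g h" if "f \<in> V" "g \<in> V" "h \<in> V"
    using that by (simp add: norm_dist_def seminorm_diff_triangle)
qed

end

locale banach_carrier = normed_carrier +
  assumes V_complete: "complete_norm_on V N"
begin

lemma mcomplete: "metric.mcomplete"
  unfolding metric.mcomplete_def
proof (intro allI impI)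
  fix s :: "nat \<Rightarrow> 'a \<Rightarrow> complex" assume s: "metric.MCauchy s"
  then have sV: "s k \<in> V" for k by (auto simp: metric.MCauchy_def)
  have "\<forall>e>0. \<exists>M. \<forall>k\<ge>M. \<forall>l\<ge>M. N (\<lambda>y. s k y - s l y) < e"
    using s sV by (auto simp: metric.MCauchy_def norm_dist_def)
  then obtain f where f: "f \<in> V" "(\<lambda>k. N (\<lambda>y. s k y - f y)) \<longlonglongrightarrow> 0"
    using V_complete sV unfolding complete_norm_on_def by blast
  have "(\<lambda>k. norm_dist (s k) f) \<longlonglongrightarrow> 0"
    using f sV by (simp add: norm_dist_def)
  then have "limitin metric.mtopology s f sequentially"
    using f sV by (simp add: metric.limitin_metric_dist_null)
  then show "\<exists>f. limitin metric.mtopology s f sequentially" by blast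
qed

text \<open>Baire category: the closed sets \<open>E m\<close> cover \<open>V\<close>, so one of
  them contains a ball, and a bound on a ball spreads to all of \<open>V\<close> by
  homogeneity.\<close>

lemma uniform_boundedness:
  assumes semi: "\<And>q. q \<in> S \<Longrightarrow> seminormed_space V q"
    and cont: "\<And>q. q \<in> S \<Longrightarrow> \<exists>K. \<forall>f\<in>V. q f \<le> K * N f"
    and ptw: "\<And>f. f \<in> V \<Longrightarrow> \<exists>M. \<forall>q\<in>S. q f \<le> M"
  shows "\<exists>K\<ge>0. \<forall>q\<in>S. \<forall>f\<in>V. q f \<le> K * N f"
proof -
  define E where "E m = {f \<in> V. \<forall>q\<in>S. q f \<le> real m}" for m :: nat
  have closed: "closedin metric.mtopology (E m)" for m
    unfolding metric.closedin_metric
  proof (intro conjI allI impI)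
    show "E m \<subseteq> V" by (auto simp: E_def)
    fix f assume f: "f \<in> V - E m"
    then obtain q where q: "q \<in> S" "real m < q f" by (force simp: E_def)
    interpret q: seminormed_space V q using semi q by blast
    obtain K where K: "\<And>f. f \<in> V \<Longrightarrow> q f \<le> K * N f" using cont q by blast
    \<comment> \<open>Inside this radius \<open>q\<close> changes by less than
      \<open>q f - m\<close>, hence stays above m. The maximum with 1 guards against a
      \<open>K\<close> that is zero or negative.\<close>
    define r where "r = (q f - real m) / max K 1"
    have "g \<notin> E m" if "g \<in> metric.mball f r" for g
    proof -
      have g: "g \<in> V" "N (\<lambda>y. f y - g y) < r" using that f by (auto simp: norm_dist_def)
      have fg: "(\<lambda>y. f y - g y) \<in> V" using f g by (simp add: diff_mem)
      have "q f \<le> q (\<lambda>y. f y - g y) + q g"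
        using q.seminorm_add[OF fg g(1)] by simp
      also have "q (\<lambda>y. f y - g y) \<le> K * N (\<lambda>y. f y - g y)" using K fg .
      also have "\<dots> \<le> max K 1 * N (\<lambda>y. f y - g y)"
        using seminorm_nonneg[OF fg] by (intro mult_right_mono) auto
      also have "\<dots> < max K 1 * r" using g by (intro mult_strict_left_mono) auto
      also have "\<dots> = q f - real m" by (simp add: r_def max_def)
      finally show ?thesis using q by (force simp: E_def)
    qed
    moreover have "r > 0" using q by (simp add: r_def less_max_iff_disj)
    ultimately show "\<exists>r>0. disjnt (E m) (metric.mball f r)"
      by (auto simp: disjnt_iff)
  qed
  have "\<exists>m. f \<in> E m" if "f \<in> V" for f
  proof -
    obtain M where "\<forall>q\<in>S. q f \<le> M" using ptw \<open>f \<in> V\<close> by blast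
    moreover obtain m where "M \<le> real m" using real_arch_simple by blast
    ultimately have "f \<in> E m" using that by (auto simp: E_def intro: order_trans)
    then show ?thesis by blast
  qed
  then have "\<Union> (range E) = V" by (auto simp: E_def)
  moreover have "metric.mtopology interior_of V = V"
    using interior_of_topspace[of metric.mtopology] by simp
  moreover have "V \<noteq> {}" using zero_mem by blast
  ultimately have "\<not> (\<forall>m. metric.mtopology interior_of E m = {})"
    using metric.metric_Baire_category_alt[OF mcomplete, of "range E"] closed by auto
  then obtain m f where "f \<in> metric.mtopology interior_of E m" by blast
  then obtain r where r: "r > 0" "metric.mball f r \<subseteq> E m"
    using interior_of_subset[of metric.mtopology "E m"]
    by (metis metric.openin_mtopology openin_interior_of subset_trans)
  have f: "f \<in> E m" "f \<in> V"
    using \<open>f \<in> _\<close> interior_of_subset[of metric.mtopology "E m"] by (auto simp: E_def)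
  \<comment> \<open>Moving from the centre \<open>f\<close> by r/2 in the direction of
    \<open>g\<close> stays in the ball. There \<open>q\<close> is at most m, so
    \<open>q (t g) \<le> 2 m\<close> with t = r/(2 N g), whence the factor 4.\<close>
  have "q g \<le> (4 * real m / r) * N g" if q: "q \<in> S" and g: "g \<in> V" for q g
  proof (cases "N g = 0")
    case True
    interpret q: seminormed_space V q using semi q by blast
    from True show ?thesis using norm_eq_zero_iff[OF g] q.seminorm_zero by simp
  next
    case False
    interpret q: seminormed_space V q using semi q by blast
    have pos: "N g > 0" using False seminorm_nonneg[OF g] by simp
    define t where "t = r / (2 * N g)"
    have t: "t > 0" using pos r by (simp add: t_def)
    have tg: "(\<lambda>y. complex_of_real t * g y) \<in> V" using g by (rule scale_mem)
    define h where "h y = f y + complex_of_real t * g y" for y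
    have h: "h \<in> V" unfolding h_def[abs_def] using f tg by (intro add_mem)
    have "N (\<lambda>y. f y - h y) = N (\<lambda>y. - (complex_of_real t * g y))" by (simp add: h_def)
    also have "\<dots> = t * N g"
      using seminorm_minus[OF tg] seminorm_scale[OF g, of "complex_of_real t"] t by simp
    also have "\<dots> < r" using pos r by (simp add: t_def)
    finally have "h \<in> E m" using r f h by (auto simp: norm_dist_def)
    then have "q f \<le> real m" "q h \<le> real m" using f q by (auto simp: E_def)
    moreover have "q (\<lambda>y. complex_of_real t * g y) \<le> q h + q (\<lambda>y. - f y)"
      using q.seminorm_add[OF h minus_mem[OF f(2)]] by (simp add: h_def)
    moreover have "q (\<lambda>y. complex_of_real t * g y) = t * q g"
      using q.seminorm_scale[OF g, of "complex_of_real t"] t by simp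
    ultimately have "t * q g \<le> 2 * real m" using q.seminorm_minus[OF f(2)] by simp
    then show ?thesis using pos r by (simp add: t_def field_simps)
  qed
  then show ?thesis using r by (intro exI[of _ "4 * real m / r"]) auto
qed

end

section \<open>The dual\<close>

context normed_carrier
begin

lemma dual_linear: "\<psi> \<in> dual V N \<Longrightarrow> linear_functional V \<psi>"
  by (simp add: dual_def)

lemma dual_bdd_above:
  assumes "\<psi> \<in> dual V N"
  shows "bdd_above ((\<lambda>f. cmod (\<psi> f)) ` {f \<in> V. N f \<le> 1})"
proof -
  obtain C where C: "\<And>f. f \<in> V \<Longrightarrow> cmod (\<psi> f) \<le> C * N f" using assms by (auto simp: dual_def)
  \<comment> \<open>The constant \<open>C\<close> in the definition of the dual carries no
    sign.\<close>
  have "cmod (\<psi> f) \<le> max C 0" if "f \<in> V" "N f \<le> 1" for f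
  proof -
    have "C * N f \<le> max C 0 * 1"
      using that seminorm_nonneg[of f] by (intro mult_mono) auto
    with C[OF that(1)] show ?thesis by simp
  qed
  then show ?thesis by (intro bdd_aboveI[of _ "max C 0"]) auto
qed

lemma dual_norm_nonneg:
  assumes "\<psi> \<in> dual V N" shows "0 \<le> dual_norm V N \<psi>"
proof -
  have "cmod (\<psi> (\<lambda>_. 0)) \<le> dual_norm V N \<psi>"
    unfolding dual_norm_def
    by (intro cSUP_upper dual_bdd_above assms) (auto simp: zero_mem seminorm_zero)
  then show ?thesis using norm_ge_zero order_trans by blast
qed

lemma dual_norm_bound:
  assumes \<psi>: "\<psi> \<in> dual V N" and f: "f \<in> V"
  shows "cmod (\<psi> f) \<le> dual_norm V N \<psi> * N f"
proof -
  have scale: "\<psi> (\<lambda>y. c * f y) = c * \<psi> f" for c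
    using dual_linear[OF \<psi>] f by (simp add: linear_functional_def)
  show ?thesis
  proof (cases "N f = 0")
    case True
    then show ?thesis using norm_eq_zero_iff[OF f] scale[of 0] by simp
  next
    case False
    then have pos: "N f > 0" using seminorm_nonneg[OF f] by simp
    have "cmod (\<psi> (\<lambda>y. complex_of_real (1 / N f) * f y)) \<le> dual_norm V N \<psi>"
      unfolding dual_norm_def
    proof (intro cSUP_upper dual_bdd_above \<psi> CollectI conjI scale_mem f)
      show "N (\<lambda>y. complex_of_real (1 / N f) * f y) \<le> 1"
        using seminorm_scale[OF f, of "complex_of_real (1 / N f)"] pos by (simp add: norm_divide)
    qed
    then show ?thesis unfolding scale using pos by (simp add: norm_mult norm_divide field_simps)
  qed
qed

lemma dual_norm_le:
  assumes "\<And>f. \<lbrakk>f \<in> V; N f \<le> 1\<rbrakk> \<Longrightarrow> cmod (\<psi> f) \<le> K"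
  shows "dual_norm V N \<psi> \<le> K"
  unfolding dual_norm_def
proof (rule cSUP_least)
  show "{f \<in> V. N f \<le> 1} \<noteq> {}" using zero_mem seminorm_zero by force
qed (use assms in auto)

lemma dual_norm_bound_unit:
  assumes "\<psi> \<in> dual V N" "f \<in> V" "N f \<le> 1"
  shows "cmod (\<psi> f) \<le> dual_norm V N \<psi>"
  unfolding dual_norm_def by (intro cSUP_upper dual_bdd_above) (use assms in auto)

sublocale dual: seminormed_space "dual V N" "dual_norm V N"
proof
  have add: "(\<lambda>f. \<psi> f + \<eta> f) \<in> dual V N" if \<psi>: "\<psi> \<in> dual V N" and \<eta>: "\<eta> \<in> dual V N" for \<psi> \<eta>
  proof -
    have "cmod (\<psi> f + \<eta> f) \<le> (dual_norm V N \<psi> + dual_norm V N \<eta>) * N f" if "f \<in> V" for f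
      using norm_triangle_ineq[of "\<psi> f" "\<eta> f"] dual_norm_bound[OF \<psi> that] dual_norm_bound[OF \<eta> that]
      by (simp add: distrib_right)
    moreover have "linear_functional V (\<lambda>f. \<psi> f + \<eta> f)"
      using dual_linear[OF \<psi>] dual_linear[OF \<eta>]
      by (simp add: linear_functional_def distrib_left)
    ultimately show ?thesis unfolding dual_def by blast
  qed
  have scale: "(\<lambda>f. c * \<psi> f) \<in> dual V N" if \<psi>: "\<psi> \<in> dual V N" for c \<psi>
  proof -
    have "cmod (c * \<psi> f) \<le> (cmod c * dual_norm V N \<psi>) * N f" if "f \<in> V" for f
      using dual_norm_bound[OF \<psi> that] by (simp add: norm_mult mult.assoc mult_left_mono)
    moreover have "linear_functional V (\<lambda>f. c * \<psi> f)"
      using dual_linear[OF \<psi>] by (simp add: linear_functional_def distrib_left)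
    ultimately show ?thesis unfolding dual_def by blast
  qed
  have zero: "(\<lambda>_. 0) \<in> dual V N"
    by (auto simp: dual_def linear_functional_def intro!: exI[of _ 0])
  show "complex_subspace (dual V N)"
    using add scale zero by (simp add: complex_subspace_def)
  show "dual_norm V N (\<lambda>f. \<psi> f + \<eta> f) \<le> dual_norm V N \<psi> + dual_norm V N \<eta>"
    if "\<psi> \<in> dual V N" "\<eta> \<in> dual V N" for \<psi> \<eta>
    by (intro dual_norm_le order_trans[OF norm_triangle_ineq] add_mono dual_norm_bound_unit that)
  have le: "dual_norm V N (\<lambda>f. c * \<psi> f) \<le> cmod c * dual_norm V N \<psi>" if "\<psi> \<in> dual V N" for c \<psi>
    using dual_norm_bound_unit[OF that]
    by (intro dual_norm_le) (simp add: norm_mult mult_left_mono)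
  show "dual_norm V N (\<lambda>f. c * \<psi> f) = cmod c * dual_norm V N \<psi>" if \<psi>: "\<psi> \<in> dual V N" for c \<psi>
  proof (cases "c = 0")
    case True
    then show ?thesis
      using le[OF \<psi>, of 0] dual_norm_nonneg[OF zero] by simp
  next
    case False
    \<comment> \<open>The inequality \<open>le\<close> for the factor \<open>inverse c\<close> gives
      the reverse estimate.\<close>
    have "dual_norm V N (\<lambda>f. inverse c * (c * \<psi> f)) \<le> cmod (inverse c) * dual_norm V N (\<lambda>f. c * \<psi> f)"
      by (intro le scale \<psi>)
    moreover have "(\<lambda>f. inverse c * (c * \<psi> f)) = \<psi>" using False by auto
    ultimately have "cmod c * dual_norm V N \<psi> \<le> dual_norm V N (\<lambda>f. c * \<psi> f)"
      using False by (simp add: norm_inverse norm_divide field_simps)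
    with le[OF \<psi>, of c] show ?thesis by simp
  qed
qed

end

section \<open>Characters, multipliers and BSE-functions of a commutative Banach algebra\<close>

locale banach_algebra_carrier =
  fixes A :: "('y \<Rightarrow> complex) set" and N :: "('y \<Rightarrow> complex) \<Rightarrow> real"
  assumes banach_algebra: "comm_banach_algebra A N"
begin

sublocale banach_carrier A N
  using banach_algebra
  by unfold_locales (auto simp: comm_banach_algebra_def complex_subalgebra_def)

lemma mult_mem: "\<lbrakk>f \<in> A; g \<in> A\<rbrakk> \<Longrightarrow> (\<lambda>y. f y * g y) \<in> A"
  and norm_mult_le: "\<lbrakk>f \<in> A; g \<in> A\<rbrakk> \<Longrightarrow> N (\<lambda>y. f y * g y) \<le> N f * N g"
  using banach_algebra by (auto simp: comm_banach_algebra_def complex_subalgebra_def)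

text \<open>The map \<open>g\<close> \<mapsto> \<open>f + f g\<close> contracts with factor
  \<open>N f\<close>. Its fixed point is the sum of the powers of \<open>f\<close> from the first
  on; formally, 1 + g inverts 1 - f.\<close>

lemma quasi_inverse_exists:
  assumes f: "f \<in> A" and "N f < 1"
  obtains g where "g \<in> A" "g = (\<lambda>y. f y + f y * g y)"
proof -
  have closed: "(\<lambda>y. f y + f y * g y) \<in> A" if "g \<in> A" for g
    using f that by (intro add_mem mult_mem)
  obtain g where "g \<in> A" "(\<lambda>y. f y + f y * g y) = g"
  proof (rule metric.Banach_fixedpoint_thm[OF mcomplete, of "\<lambda>g y. f y + f y * g y" "N f"])
    show "A \<noteq> {}" using f by blast
    show "(\<lambda>g y. f y + f y * g y) \<in> A \<rightarrow> A" using closed by blast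
    show "norm_dist (\<lambda>y. f y + f y * g y) (\<lambda>y. f y + f y * h y) \<le> N f * norm_dist g h"
      if "g \<in> A" "h \<in> A" for g h
      using norm_mult_le[OF f diff_mem[OF that]] that closed[OF that(1)] closed[OF that(2)]
      by (simp add: norm_dist_def right_diff_distrib)
  qed (use assms in auto)
  then show thesis using that by metis
qed

lemma character_linear:
  assumes "\<phi> \<in> characters A"
  shows "linear_functional A \<phi>"
    and character_add: "\<lbrakk>f \<in> A; g \<in> A\<rbrakk> \<Longrightarrow> \<phi> (\<lambda>y. f y + g y) = \<phi> f + \<phi> g"
    and character_scale: "f \<in> A \<Longrightarrow> \<phi> (\<lambda>y. c * f y) = c * \<phi> f"
    and character_mult: "\<lbrakk>f \<in> A; g \<in> A\<rbrakk> \<Longrightarrow> \<phi> (\<lambda>y. f y * g y) = \<phi> f * \<phi> g"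
    and character_off: "f \<notin> A \<Longrightarrow> \<phi> f = 0"
    and character_nonzero: "\<exists>f\<in>A. \<phi> f \<noteq> 0"
  using assms by (auto simp: characters_def linear_functional_def)

lemma character_diff:
  assumes \<phi>: "\<phi> \<in> characters A" and f: "f \<in> A" and g: "g \<in> A"
  shows "\<phi> (\<lambda>y. f y - g y) = \<phi> f - \<phi> g"
  using character_add[OF \<phi> f minus_mem[OF g]] character_scale[OF \<phi> g, of "-1"] by simp

text \<open>If \<open>\<phi> f = 1\<close>, then \<open>\<phi>\<close> takes contradictory values at a quasi-inverse of \<open>f\<close>.\<close>

lemma character_norm_le:
  assumes \<phi>: "\<phi> \<in> characters A" and f: "f \<in> A"
  shows "cmod (\<phi> f) \<le> N f"
proof (rule ccontr)
  assume *: "\<not> ?thesis"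
  then have nz: "\<phi> f \<noteq> 0" using seminorm_nonneg[OF f] by auto
  \<comment> \<open>If \<open>cmod (\<phi> f)\<close> exceeded \<open>N f\<close>, this scaling
    would achieve \<open>\<phi> h = 1\<close> and \<open>N h < 1\<close> together. A quasi-inverse
    \<open>g\<close> of \<open>h\<close> would then satisfy
    \<open>\<phi> g = 1 + \<phi> g\<close>.\<close>
  define h where "h y = inverse (\<phi> f) * f y" for y
  have h: "h \<in> A" unfolding h_def[abs_def] using f by (rule scale_mem)
  have "\<phi> h = 1" unfolding h_def[abs_def] using character_scale[OF \<phi> f] nz by simp
  have "N h = N f / cmod (\<phi> f)"
    unfolding h_def[abs_def] using seminorm_scale[OF f, of "inverse (\<phi> f)"]
    by (simp add: norm_inverse divide_inverse mult.commute)
  also have "\<dots> < 1" using * nz by simp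
  finally obtain g where g: "g \<in> A" "g = (\<lambda>y. h y + h y * g y)"
    using quasi_inverse_exists[OF h] by blast
  have "\<phi> g = \<phi> (\<lambda>y. h y + h y * g y)" using g(2) by (rule arg_cong)
  also have "\<dots> = \<phi> h + \<phi> h * \<phi> g"
    using character_add[OF \<phi> h mult_mem[OF h g(1)]] character_mult[OF \<phi> h g(1)] by simp
  finally show False using \<open>\<phi> h = 1\<close> by simp
qed

lemma character_dual: "\<phi> \<in> characters A \<Longrightarrow> \<phi> \<in> dual A N"
  using character_linear(1) character_norm_le by (auto simp: dual_def intro!: exI[of _ 1])

section \<open>BSE-functions as restrictions of elements of the second dual\<close>

lemma sum_append_lessThan:
  fixes u v :: "nat \<Rightarrow> 'b::comm_monoid_add"
  shows "(\<Sum>i<m + k. if i < m then u i else v (i - m)) = (\<Sum>i<m. u i) + (\<Sum>i<k. v i)"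
  by (induction k) (auto simp: add.assoc)

lemma bse_function_second_dual:
  assumes \<sigma>: "\<sigma> \<in> bse_functions A N"
  obtains \<Phi> where "\<Phi> \<in> second_dual A N" "\<And>\<phi>. \<phi> \<in> characters A \<Longrightarrow> \<Phi> \<phi> = \<sigma> \<phi>"
proof -
  obtain C where C: "C > 0"
    and bound: "\<forall>(m::nat) \<phi> c. (\<forall>i<m. \<phi> i \<in> characters A) \<longrightarrow>
      cmod (\<Sum>i<m. c i * \<sigma> (\<phi> i)) \<le> C * dual_norm A N (\<lambda>f. \<Sum>i<m. c i * \<phi> i f)"
    using \<sigma> unfolding bse_functions_def by (elim CollectE conjE exE)
  \<comment> \<open>One functional may have several representations as a combination of characters.
    A relation admits all of them, and the BSE inequality is exactly the bound that the extension
    theorem asks of it.\<close>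
  define R where "R = {z. \<exists>(m::nat) \<phi> c. (\<forall>i<m. \<phi> i \<in> characters A) \<and>
      z = ((\<lambda>f. \<Sum>i<m. c i * \<phi> i f), \<Sum>i<m. c i * \<sigma> (\<phi> i))}"
  have RI: "((\<lambda>f. \<Sum>i<m. c i * \<phi> i f), \<Sum>i<m. c i * \<sigma> (\<phi> i)) \<in> R"
    if "\<And>i. i < m \<Longrightarrow> \<phi> i \<in> characters A" for m :: nat and \<phi> c
    unfolding R_def by (intro CollectI exI[of _ m] exI[of _ \<phi>] exI[of _ c]) (simp add: that)
  have RE: "\<exists>(m::nat) \<phi> c. (\<forall>i<m. \<phi> i \<in> characters A) \<and>
      s = (\<lambda>f. \<Sum>i<m. c i * \<phi> i f) \<and> r = (\<Sum>i<m. c i * \<sigma> (\<phi> i))" if "(s, r) \<in> R" for s r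
    using that unfolding R_def by simp
  obtain \<Phi> where \<Phi>: "linear_functional (dual A N) \<Phi>"
    "\<And>\<psi>. \<psi> \<in> dual A N \<Longrightarrow> cmod (\<Phi> \<psi>) \<le> 2 * C * dual_norm A N \<psi>"
    "\<And>s r. (s, r) \<in> R \<Longrightarrow> \<Phi> s = r"
  proof (rule dual.hahn_banach[of R C])
    show "s \<in> dual A N" if "(s, r) \<in> R" for s r
    proof -
      obtain m :: nat and \<phi> c where "\<forall>i<m. \<phi> i \<in> characters A" "s = (\<lambda>f. \<Sum>i<m. c i * \<phi> i f)"
        using RE[OF \<open>(s, r) \<in> R\<close>] by (elim exE conjE)
      then show ?thesis by (simp, intro dual.sum_mem) (auto intro: character_dual)
    qed
    show "((\<lambda>_. 0), 0) \<in> R" using RI[of 0] by simp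
    show "cmod r \<le> C * dual_norm A N s" if "(s, r) \<in> R" for s r
    proof -
      obtain m :: nat and \<phi> c where "\<forall>i<m. \<phi> i \<in> characters A"
        and "s = (\<lambda>f. \<Sum>i<m. c i * \<phi> i f)" "r = (\<Sum>i<m. c i * \<sigma> (\<phi> i))"
        using RE[OF \<open>(s, r) \<in> R\<close>] by (elim exE conjE)
      with bound show ?thesis by simp
    qed
    show "((\<lambda>f. c * s f), c * r) \<in> R" if "(s, r) \<in> R" for c s r
    proof -
      obtain m :: nat and \<phi> d where "\<forall>i<m. \<phi> i \<in> characters A"
        and sr: "s = (\<lambda>f. \<Sum>i<m. d i * \<phi> i f)" "r = (\<Sum>i<m. d i * \<sigma> (\<phi> i))"
        using RE[OF \<open>(s, r) \<in> R\<close>] by (elim exE conjE)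
      then show ?thesis using RI[of m \<phi> "\<lambda>i. c * d i"]
        by (simp add: sum_distrib_left mult.assoc)
    qed
    show "((\<lambda>f. s f + s' f), r + r') \<in> R" if "(s, r) \<in> R" "(s', r') \<in> R" for s r s' r'
    proof -
      obtain m :: nat and \<phi> c where 1: "\<forall>i<m. \<phi> i \<in> characters A"
        and sr: "s = (\<lambda>f. \<Sum>i<m. c i * \<phi> i f)" "r = (\<Sum>i<m. c i * \<sigma> (\<phi> i))"
        using RE[OF \<open>(s, r) \<in> R\<close>] by (elim exE conjE)
      obtain k :: nat and \<eta> d where 2: "\<forall>i<k. \<eta> i \<in> characters A"
        and sr': "s' = (\<lambda>f. \<Sum>i<k. d i * \<eta> i f)" "r' = (\<Sum>i<k. d i * \<sigma> (\<eta> i))"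
        using RE[OF \<open>(s', r') \<in> R\<close>] by (elim exE conjE)
      \<comment> \<open>Concatenating the two families turns a sum of two combinations into a single
        one.\<close>
      define \<phi>' where "\<phi>' i = (if i < m then \<phi> i else \<eta> (i - m))" for i
      define c' where "c' i = (if i < m then c i else d (i - m))" for i
      have "((\<lambda>f. \<Sum>i<m + k. c' i * \<phi>' i f), \<Sum>i<m + k. c' i * \<sigma> (\<phi>' i)) \<in> R"
        using 1 2 by (intro RI) (auto simp: \<phi>'_def)
      moreover have "(\<Sum>i<m + k. c' i * \<phi>' i f) = s f + s' f" for f
        unfolding sr sr' sum_append_lessThan[symmetric]
        by (intro sum.cong) (auto simp: c'_def \<phi>'_def)
      moreover have "(\<Sum>i<m + k. c' i * \<sigma> (\<phi>' i)) = r + r'"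
        unfolding sr sr' sum_append_lessThan[symmetric]
        by (intro sum.cong) (auto simp: c'_def \<phi>'_def)
      ultimately show ?thesis by simp
    qed
  qed (use C in auto)
  show thesis
  proof (rule that)
    show "\<Phi> \<in> second_dual A N"
      using \<Phi>(1,2) by (auto simp: second_dual_def dual_def[of "dual A N"])
    show "\<Phi> \<phi> = \<sigma> \<phi>" if "\<phi> \<in> characters A" for \<phi>
      using \<Phi>(3)[OF RI[of 1 "\<lambda>_. \<phi>" "\<lambda>_. 1"]] that by simp
  qed
qed

text \<open>Multiplying a preimage \<open>\<Phi>\<close> of \<open>\<sigma>\<close> in the second dual by \<open>a\<close> lands in \<open>A\<close> again.\<close>

lemma bse_function_mult:
  assumes ideal: "ideal_in_second_dual A N"
    and \<sigma>: "\<sigma> \<in> bse_functions A N" and a: "a \<in> A"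
  obtains b where "b \<in> A" "\<And>\<phi>. \<phi> \<in> characters A \<Longrightarrow> \<phi> b = \<sigma> \<phi> * \<phi> a"
proof -
  obtain \<Phi> where \<Phi>: "\<Phi> \<in> second_dual A N" "\<And>\<phi>. \<phi> \<in> characters A \<Longrightarrow> \<Phi> \<phi> = \<sigma> \<phi>"
    using bse_function_second_dual[OF \<sigma>] by blast
  obtain b where b: "b \<in> A"
    and prod: "arens_product A N \<Phi> (canonical_embedding A N a) = canonical_embedding A N b"
    using ideal a \<Phi>(1) unfolding ideal_in_second_dual_def by blast
  have "\<phi> b = \<sigma> \<phi> * \<phi> a" if \<phi>: "\<phi> \<in> characters A" for \<phi>
  proof -
    have \<phi>': "\<phi> \<in> dual A N" using character_dual[OF \<phi>] .
    \<comment> \<open>Multiplicativity makes \<phi> an eigenvector of the module actions: acting by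
      \<open>c\<close> multiplies it by \<open>\<phi> c\<close>, and acting by the image of
      \<open>a\<close> multiplies it by \<open>\<phi> a\<close>. Linearity of \<Phi> then evaluates
      the Arens product.\<close>
    have "dual_module_act A \<phi> c = (\<lambda>b. \<phi> c * \<phi> b)" if "c \<in> A" for c
      using that character_mult[OF \<phi>] character_off[OF \<phi>] by (auto simp: dual_module_act_def)
    then have "second_dual_act A (canonical_embedding A N a) \<phi> = (\<lambda>c. \<phi> a * \<phi> c)"
      using dual.scale_mem[OF \<phi>'] character_off[OF \<phi>]
      by (auto simp: second_dual_act_def canonical_embedding_def)
    moreover have "\<Phi> (\<lambda>c. \<phi> a * \<phi> c) = \<phi> a * \<sigma> \<phi>"
      using \<Phi> \<phi> \<phi>' by (simp add: second_dual_def dual_def[of "dual A N"] linear_functional_def)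
    ultimately show ?thesis
      using fun_cong[OF prod, of \<phi>] \<phi>'
      by (simp add: arens_product_def canonical_embedding_def[of _ _ b] mult.commute)
  qed
  with b that show thesis by blast
qed

section \<open>Multipliers and bounded approximate identities\<close>

text \<open>The maps \<open>f \<mapsto> T e \<cdot> f = e \<cdot> T f\<close>, with \<open>e\<close> in the approximate identity, are pointwise
  bounded, which replaces the closed graph theorem in bounding \<open>T\<close>.\<close>

lemma multiplier_bounded_on_approximate_identity:
  assumes T: "T \<in> multipliers A"
    and F: "F \<noteq> bot" "eventually (\<lambda>e. e \<in> A \<and> N e \<le> C) F"
    and lim: "\<And>f. f \<in> A \<Longrightarrow> ((\<lambda>e. N (\<lambda>x. f x * e x - f x)) \<longlongrightarrow> 0) F"
  obtains D where "\<And>e. \<lbrakk>e \<in> A; N e \<le> C\<rbrakk> \<Longrightarrow> N (T e) \<le> D"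
proof -
  have T_mem: "T a \<in> A" if "a \<in> A" for a using T that by (simp add: multipliers_def)
  define S where "S = (\<lambda>e f. N (\<lambda>y. T e y * f y)) ` {e \<in> A. N e \<le> C}"
  have "\<exists>K\<ge>0. \<forall>q\<in>S. \<forall>f\<in>A. q f \<le> K * N f"
  proof (rule uniform_boundedness)
    fix q assume "q \<in> S"
    then obtain e where e: "e \<in> A" and q: "q = (\<lambda>f. N (\<lambda>y. T e y * f y))" by (auto simp: S_def)
    show "seminormed_space A q"
    proof
      show "complex_subspace A" by (rule subspace)
      show "q (\<lambda>y. f y + g y) \<le> q f + q g" if "f \<in> A" "g \<in> A" for f g
        using seminorm_add[OF mult_mem[OF T_mem[OF e] that(1)] mult_mem[OF T_mem[OF e] that(2)]]
        by (simp add: q distrib_left)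
      show "q (\<lambda>y. c * f y) = cmod c * q f" if "f \<in> A" for c f
        using seminorm_scale[OF mult_mem[OF T_mem[OF e] that], of c]
        by (simp add: q mult.left_commute)
    qed
    show "\<exists>K. \<forall>f\<in>A. q f \<le> K * N f"
      using norm_mult_le[OF T_mem[OF e]] by (auto simp: q)
  next
    fix f assume f: "f \<in> A"
    have "q f \<le> C * N (T f)" if "q \<in> S" for q
    proof -
      obtain e where e: "e \<in> A" "N e \<le> C" and q: "q = (\<lambda>f. N (\<lambda>y. T e y * f y))"
        using \<open>q \<in> S\<close> by (auto simp: S_def)
      \<comment> \<open>The multiplier identity moves \<open>T\<close> from \<open>e\<close> to
        \<open>f\<close>, which makes the bound \<open>C * N (T f)\<close> independent of
        \<open>e\<close>.\<close>
      have "(\<lambda>y. T e y * f y) = (\<lambda>y. e y * T f y)"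
        using T e f by (simp add: multipliers_def)
      then have "q f \<le> N e * N (T f)" using norm_mult_le[OF e(1) T_mem[OF f]] by (simp add: q)
      also have "\<dots> \<le> C * N (T f)"
        using e seminorm_nonneg[OF T_mem[OF f]] by (intro mult_right_mono)
      finally show ?thesis .
    qed
    then show "\<exists>M. \<forall>q\<in>S. q f \<le> M" by blast
  qed
  then obtain K where K: "K \<ge> 0" "\<And>q f. \<lbrakk>q \<in> S; f \<in> A\<rbrakk> \<Longrightarrow> q f \<le> K * N f" by blast
  have "N (T e) \<le> K * C" if e: "e \<in> A" "N e \<le> C" for e
  proof -
    \<comment> \<open>Here \<open>e\<close> stays fixed while \<open>d\<close> runs through the
      approximate identity: \<open>T e \<cdot> d\<close> has norm at most \<open>K * C\<close> and
      tends to \<open>T e\<close>.\<close>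
    have "eventually (\<lambda>d. N (T e) \<le> K * C + N (\<lambda>x. T e x * d x - T e x)) F"
      using F(2)
    proof eventually_elim
      case (elim d)
      have m: "(\<lambda>x. T e x * d x) \<in> A" using mult_mem[OF T_mem[OF e(1)]] elim by blast
      have "N (T e) \<le> N (\<lambda>x. T e x * d x) + N (\<lambda>x. T e x - T e x * d x)"
        using seminorm_add[OF m diff_mem[OF T_mem[OF e(1)] m]] by simp
      also have "N (\<lambda>x. T e x * d x) \<le> K * N d"
        using K(2)[of "\<lambda>f. N (\<lambda>y. T e y * f y)" d] e elim by (auto simp: S_def)
      also have "K * N d \<le> K * C" using elim K(1) by (intro mult_left_mono) auto
      finally show ?case using seminorm_diff_commute[OF T_mem[OF e(1)] m] by simp
    qed
    moreover have "((\<lambda>d. K * C + N (\<lambda>x. T e x * d x - T e x)) \<longlongrightarrow> K * C + 0) F"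
      by (intro tendsto_intros lim T_mem e)
    ultimately show ?thesis using tendsto_lowerbound[OF _ _ F(1)] by force
  qed
  with that show thesis by blast
qed

lemma multiplier_transform_bse:
  assumes bai: "has_bounded_approximate_identity_in A N B" and B: "B \<subseteq> A"
    and \<sigma>: "\<sigma> \<in> multiplier_transforms A"
  shows "\<sigma> \<in> bse_functions A N"
proof -
  obtain T where T: "T \<in> multipliers A"
    and T_\<sigma>: "\<And>a \<phi>. \<lbrakk>a \<in> A; \<phi> \<in> characters A\<rbrakk> \<Longrightarrow> \<phi> (T a) = \<sigma> \<phi> * \<phi> a"
    and \<sigma>_bc: "\<sigma> \<in> bounded_continuous_on_characters A"
    using \<sigma> by (auto simp: multiplier_transforms_def)
  obtain F C where F: "F \<noteq> bot" "F \<le> principal {e \<in> B. N e \<le> C}"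
    and lim: "\<And>f. f \<in> A \<Longrightarrow> ((\<lambda>e. N (\<lambda>x. f x * e x - f x)) \<longlongrightarrow> 0) F"
    using bai unfolding has_bounded_approximate_identity_in_def by blast
  have ev: "eventually (\<lambda>e. e \<in> A \<and> N e \<le> C) F"
    using F(2) B by (auto simp: le_principal elim!: eventually_mono)
  obtain D where D: "\<And>e. \<lbrakk>e \<in> A; N e \<le> C\<rbrakk> \<Longrightarrow> N (T e) \<le> D"
    using multiplier_bounded_on_approximate_identity[OF T F(1) ev lim] by blast
  \<comment> \<open>The product of \<open>\<phi> f\<close> with \<open>\<phi> e - 1\<close> is
    \<open>\<phi> (f e - f)\<close>, which is at most \<open>N (f e - f)\<close> in modulus because
    characters have norm at most 1.\<close>
  have char_lim: "((\<lambda>e. \<phi> e) \<longlongrightarrow> 1) F" if \<phi>: "\<phi> \<in> characters A" for \<phi>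
  proof -
    obtain f where f: "f \<in> A" "\<phi> f \<noteq> 0" using character_nonzero[OF \<phi>] by blast
    have le: "eventually (\<lambda>e. norm (\<phi> e - 1) \<le> N (\<lambda>x. f x * e x - f x) / cmod (\<phi> f)) F"
      using ev
    proof eventually_elim
      case (elim e)
      have fe: "(\<lambda>x. f x * e x) \<in> A" using mult_mem f elim by blast
      have "cmod (\<phi> f) * cmod (\<phi> e - 1) = cmod (\<phi> (\<lambda>x. f x * e x - f x))"
        using character_diff[OF \<phi> fe f(1)] character_mult[OF \<phi> f(1), of e] elim
        by (simp add: right_diff_distrib flip: norm_mult)
      also have "\<dots> \<le> N (\<lambda>x. f x * e x - f x)"
        by (intro character_norm_le \<phi> diff_mem fe f)
      finally show ?case using f by (simp add: field_simps)
    qed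
    have "((\<lambda>e. N (\<lambda>x. f x * e x - f x) / cmod (\<phi> f)) \<longlongrightarrow> 0 / cmod (\<phi> f)) F"
      using f by (intro tendsto_intros lim) auto
    then have "((\<lambda>e. \<phi> e - 1) \<longlongrightarrow> 0) F"
      by (intro Lim_null_comparison[OF le]) simp
    then show ?thesis by (simp add: LIM_zero_iff)
  qed
  \<comment> \<open>A BSE constant has to be positive, while \<open>D\<close> carries no
    sign.\<close>
  define K where "K = max D 0 + 1"
  have "cmod (\<Sum>i<m. c i * \<sigma> (\<phi> i)) \<le> K * dual_norm A N (\<lambda>f. \<Sum>i<m. c i * \<phi> i f)"
    if \<phi>: "\<forall>i<m. \<phi> i \<in> characters A" for m :: nat and \<phi> c
  proof -
    define \<psi> where "\<psi> f = (\<Sum>i<m. c i * \<phi> i f)" for f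
    have \<psi>: "\<psi> \<in> dual A N"
      unfolding \<psi>_def[abs_def] using \<phi> by (intro dual.sum_mem) (auto intro: character_dual)
    \<comment> \<open>Since \<open>\<sigma> (\<phi> i) * \<phi> i e = \<phi> i (T e)\<close>, the
      sum is \<psi> evaluated at \<open>T e\<close>, whose norm is at most \<open>K\<close>.\<close>
    have "eventually (\<lambda>e. cmod (\<Sum>i<m. c i * (\<sigma> (\<phi> i) * \<phi> i e)) \<le> K * dual_norm A N \<psi>) F"
      using ev
    proof eventually_elim
      case (elim e)
      have Te: "T e \<in> A" using T elim by (simp add: multipliers_def)
      have "(\<Sum>i<m. c i * (\<sigma> (\<phi> i) * \<phi> i e)) = \<psi> (T e)"
        using T_\<sigma> \<phi> elim by (simp add: \<psi>_def)
      also have "cmod \<dots> \<le> dual_norm A N \<psi> * N (T e)" by (rule dual_norm_bound[OF \<psi> Te])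
      also have "\<dots> \<le> dual_norm A N \<psi> * K"
        using D[of e] elim dual_norm_nonneg[OF \<psi>] by (intro mult_left_mono) (auto simp: K_def)
      finally show ?case by (simp add: mult.commute)
    qed
    moreover have "((\<lambda>e. cmod (\<Sum>i<m. c i * (\<sigma> (\<phi> i) * \<phi> i e)))
        \<longlongrightarrow> cmod (\<Sum>i<m. c i * (\<sigma> (\<phi> i) * 1))) F"
      using \<phi> by (intro tendsto_intros char_lim) auto
    ultimately have "cmod (\<Sum>i<m. c i * (\<sigma> (\<phi> i) * 1)) \<le> K * dual_norm A N \<psi>"
      by (intro tendsto_upperbound[OF _ _ F(1)])
    then show ?thesis by (simp add: \<psi>_def[abs_def])
  qed
  moreover have "K > 0" by (simp add: K_def add_nonneg_pos)
  ultimately show ?thesis using \<sigma>_bc unfolding bse_functions_def by blast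
qed

end

theorem proposition3p5:
  fixes A :: "('x::t2_space \<Rightarrow> complex) set"
    and N :: "('x \<Rightarrow> complex) \<Rightarrow> real"
    and \<tau> :: "'x \<Rightarrow> complex"
    and n :: nat
  assumes "locally_compact_space (euclidean :: 'x topology)"
    and "\<not> compact (UNIV :: 'x set)"
    and "banach_function_algebra A N"
    and "natural_algebra A"
    and "regular_algebra A"
    and "has_bounded_approximate_identity_in A N (compact_support_part A)"
    and "n \<ge> 1"
    and "\<tau> \<in> local_functions A"
    and "ideal_in_second_dual A N"
    and "bse_algebra (weighted_algebra A \<tau> n) (weighted_norm N \<tau> n)"
  shows "bse_algebra A N"
proof -
  interpret banach_algebra_carrier A N
    using assms(3) by unfold_locales (simp add: banach_function_algebra_def)
  have chars: "characters A = range (point_evaluation A)"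
    using assms(4) by (auto simp: natural_algebra_def homeomorphism_def)
  have "without_order A"
    unfolding without_order_def
  proof (intro ballI impI ext)
    fix a x assume "a \<in> A" and *: "\<forall>b\<in>A. (\<lambda>y. a y * b y) = (\<lambda>_. 0)"
    obtain b where "b \<in> A" "b x \<noteq> 0"
      using assms(3) unfolding banach_function_algebra_def by blast
    with * show "a x = 0" by (metis mult_eq_0_iff)
  qed
  moreover have "\<sigma> \<in> multiplier_transforms A" if \<sigma>: "\<sigma> \<in> bse_functions A N" for \<sigma>
  proof -
    \<comment> \<open>The candidate multiplier is multiplication by \<sigma>, transported to the
      underlying space. Its only nontrivial property is that it maps \<open>A\<close> into
      \<open>A\<close>; there the element supplied by the ideal property agrees with
      \<open>T a\<close> at every point, because all evaluations are characters.\<close>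
    define T where "T a x = \<sigma> (point_evaluation A x) * a x" for a x
    have T_mem: "T a \<in> A" if a: "a \<in> A" for a
    proof -
      obtain b where b: "b \<in> A" "\<And>\<phi>. \<phi> \<in> characters A \<Longrightarrow> \<phi> b = \<sigma> \<phi> * \<phi> a"
        using bse_function_mult[OF assms(9) \<sigma> a] by blast
      have "T a = b"
      proof
        fix x
        show "T a x = b x"
          using b(2)[of "point_evaluation A x"] b(1) a
          by (simp add: chars T_def) (simp add: point_evaluation_def)
      qed
      with b show ?thesis by simp
    qed
    then have "T \<in> multipliers A"
      by (simp add: multipliers_def T_def fun_eq_iff distrib_left mult.left_commute)
    moreover have "\<phi> (T a) = \<sigma> \<phi> * \<phi> a" if "a \<in> A" "\<phi> \<in> characters A" for a \<phi>
      using that T_mem[of a] by (auto simp: chars point_evaluation_def T_def)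
    ultimately show ?thesis
      using \<sigma> unfolding multiplier_transforms_def bse_functions_def by blast
  qed
  moreover have "\<sigma> \<in> bse_functions A N" if "\<sigma> \<in> multiplier_transforms A" for \<sigma>
    using multiplier_transform_bse[OF assms(6) _ that] by (auto simp: compact_support_part_def)
  ultimately show ?thesis
    unfolding bse_algebra_def using banach_algebra by blast
qed

end
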